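(* Let $a>c\ge 1$ be integers and let $L_h>c$ be an integer. Let $\mathbf{H}_s$ be a binary matrix with $a$ rows and $L_h$ columns whose $i$-th row contains exactly $w_i\ge 1$ ones, $i=0,1,\ldots,a-1$. Let $\mathbf{H}$ be the semi-infinite parity-check matrix obtained from $\mathbf{H}_s$ with shift $c$. If the Tanner graph of $\mathbf{H}$ contains no local cycle of length less than $6$ (that is, no local cycle of length $4$), then $$L_h \ge \max\left\{c+1,\ \left\lceil \frac{\sum_{i=0}^{a-1}\binom{w_i}{2}+\binom{c+1}{2}}{c}\right\rceil\right\}.$$
   Context: Syndrome former matrix and parity-check matrix: given integers $a>c\ge1$ and a binary $a\times L_h$ matrix $\mathbf{H}_s$ (the syndrome former matrix; rows indexed $0,\ldots,a-1$, columns indexed $0,\ldots,L_h-1$), the semi-infinite binary parity-check matrix $\mathbf{H}$ consists of the transpose $\mathbf{H}_s^T$ and all its replicas, each shifted down by $c$ rows with respect to the previous one. Explicitly, the rows of $\mathbf{H}$ are indexed by integers $n\ge 0$, its columns by pairs $(t,i)$ with $t\ge 0$ an integer and $0\le i\le a-1$, and the entry in row $n$ and column $(t,i)$ is $1$ if and only if $0\le n-tc\le L_h-1$ and the entry of $\mathbf{H}_s$ in row $i$, column $n-tc$ is $1$. Tanner graph: the bipartite graph whose two vertex classes are the rows and the columns of $\mathbf{H}$, a row being adjacent to a column if and only if the corresponding entry of $\mathbf{H}$ is $1$. A local cycle is a closed walk of positive length in the Tanner graph that starts at a node and returns to it, passing at most once through any edge; its length is its number of edges. *)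

theory Defs
  imports Jordan_Normal_Form.Matrix "HOL-Library.Z2"
begin

text \<open>
  The semi-infinite parity-check matrix of a syndrome former matrix \<open>Hs\<close> with shift \<open>c\<close>: its
  columns are the pairs \<open>(t, i)\<close> with \<open>i < dim_row Hs\<close>, and block \<open>t\<close> is the transpose of \<open>Hs\<close>
  moved down by \<open>t * c\<close> rows. The guard \<open>t * c \<le> n\<close> keeps the natural-number subtraction exact.
\<close>

definition parity_check :: "nat \<Rightarrow> bit mat \<Rightarrow> nat \<Rightarrow> nat \<times> nat \<Rightarrow> bit" where
  "parity_check c Hs n = (\<lambda>(t, i).
     if t * c \<le> n \<and> n - t * c < dim_col Hs then Hs $$ (i, n - t * c) else 0)"

datatype tanner_node = Row nat | Col "nat \<times> nat"

definition tanner_nodes :: "bit mat \<Rightarrow> tanner_node set" where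
  "tanner_nodes Hs = range Row \<union> {Col (t, i) |t i. i < dim_row Hs}"

definition tanner_edges :: "nat \<Rightarrow> bit mat \<Rightarrow> tanner_node set set" where
  "tanner_edges c Hs =
     {{Row n, Col (t, i)} |n t i. i < dim_row Hs \<and> parity_check c Hs n (t, i) = 1}"

text \<open>
  A walk in a simple graph is given by the list of the nodes it visits, the start node of a closed
  walk being listed again at the end; a walk along \<open>k\<close> edges is thus a list of \<open>k + 1\<close> nodes.
  Edges are unordered, so that traversing an edge back and forth counts as using it twice.
\<close>

definition walk_edges :: "'v list \<Rightarrow> 'v set list" where
  "walk_edges vs = map2 (\<lambda>u v. {u, v}) vs (tl vs)"

definition walk_length :: "'v list \<Rightarrow> nat" where
  "walk_length vs = length (walk_edges vs)"

definition local_cycle :: "'v set \<Rightarrow> 'v set set \<Rightarrow> 'v list \<Rightarrow> bool" where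
  "local_cycle V E vs \<longleftrightarrow>
     set vs \<subseteq> V \<and> set (walk_edges vs) \<subseteq> E \<and> walk_length vs > 0 \<and>
     hd vs = last vs \<and> distinct (walk_edges vs)"

end

theory Submission
  imports Defs
begin

text \<open>
  A pair of ones at positions \<open>j < k\<close> of a row of \<open>Hs\<close> is sent to
  \<open>(j mod c, k - j)\<close>. Two pairs with the same image can be shifted, by multiples of \<open>c\<close>, onto the
  same two rows of the parity-check matrix, so they yield two columns sharing two ones, a
  4-cycle. Hence the map is injective, and its image lies in the set of all \<open>(r, d)\<close> with
  \<open>r < c\<close>, \<open>d \<ge> 1\<close> and \<open>r + d < Lh\<close>, which has \<open>c * Lh - (c + 1 choose 2)\<close> elements.
\<close>

lemma tanner_edge_shift:
  assumes "i < dim_row Hs" and "j < dim_col Hs" and "Hs $$ (i, j) = 1"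
  shows "{Row (j + t * c), Col (t, i)} \<in> tanner_edges c Hs"
proof -
  have "parity_check c Hs (j + t * c) (t, i) = 1"
    using assms by (simp add: parity_check_def)
  with assms(1) show ?thesis
    unfolding tanner_edges_def by blast
qed

text \<open>The four edges of this walk are pairwise distinct exactly because both the two rows and
  the two columns differ.\<close>

lemma local_cycle_of_two_columns:
  assumes "{Row m, Col (t, i)} \<in> tanner_edges c Hs" "{Row n, Col (t, i)} \<in> tanner_edges c Hs"
    and "{Row m, Col (s, l)} \<in> tanner_edges c Hs" "{Row n, Col (s, l)} \<in> tanner_edges c Hs"
    and "i < dim_row Hs" "l < dim_row Hs" "m \<noteq> n" "(t, i) \<noteq> (s, l)"
  shows "local_cycle (tanner_nodes Hs) (tanner_edges c Hs)
    [Row m, Col (t, i), Row n, Col (s, l), Row m]"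
  using assms
  by (auto simp: local_cycle_def walk_length_def walk_edges_def tanner_nodes_def
      doubleton_eq_iff insert_commute)

lemma pair_of_ones_unique:
  fixes c :: nat
  assumes free: "\<not> (\<exists>vs. local_cycle (tanner_nodes Hs) (tanner_edges c Hs) vs \<and> walk_length vs < 6)"
    and i: "i < dim_row Hs" and l: "l < dim_row Hs"
    and jk: "j < k" "k < dim_col Hs" "Hs $$ (i, j) = 1" "Hs $$ (i, k) = 1"
    and pq: "p < q" "q < dim_col Hs" "Hs $$ (l, p) = 1" "Hs $$ (l, q) = 1"
    and diff: "k - j = q - p" and cong: "j mod c = p mod c"
  shows "i = l \<and> j = p \<and> k = q"
proof (rule ccontr)
  assume neq: "\<not> (i = l \<and> j = p \<and> k = q)"
  \<comment> \<open>The quotients are swapped: each pair is shifted by the block number of the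
    other. As the residues agree, \<open>j\<close> and \<open>p\<close> both land in row
    \<open>j mod c + (s + t) * c\<close>, and equal differences then make \<open>k\<close> and
    \<open>q\<close> meet as well.\<close>
  define t where "t = p div c"
  define s where "s = j div c"
  have j: "j = s * c + j mod c" and p: "p = t * c + j mod c"
    unfolding s_def t_def cong by simp_all (simp flip: cong)
  have m: "j + t * c = p + s * c"
    using j p by linarith
  have n: "k + t * c = q + s * c"
    using m diff jk(1) pq(1) by linarith
  \<comment> \<open>If the columns coincided, the shifts would be equal and cancel in
    \<open>m\<close> and \<open>n\<close>, so the two pairs would be the same pair of the same
    row.\<close>
  have cols: "(t, i) \<noteq> (s, l)"
    using neq m n by auto
  have "local_cycle (tanner_nodes Hs) (tanner_edges c Hs)
    [Row (j + t * c), Col (t, i), Row (k + t * c), Col (s, l), Row (j + t * c)]"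
  proof (rule local_cycle_of_two_columns)
    show "{Row (j + t * c), Col (t, i)} \<in> tanner_edges c Hs"
      "{Row (k + t * c), Col (t, i)} \<in> tanner_edges c Hs"
      using tanner_edge_shift i jk by auto
    show "{Row (j + t * c), Col (s, l)} \<in> tanner_edges c Hs"
      "{Row (k + t * c), Col (s, l)} \<in> tanner_edges c Hs"
      unfolding m n using tanner_edge_shift l pq by auto
  qed (use i l jk cols in auto)
  moreover have "walk_length
      [Row (j + t * c), Col (t, i), Row (k + t * c), Col (s, l), Row (j + t * c)] < 6"
    by (simp add: walk_length_def walk_edges_def)
  ultimately show False
    using free by blast
qed

text \<open>The fibre over \<open>r\<close> has \<open>L - r - 1\<close> elements, and the deficits
  \<open>r + 1\<close> for \<open>r < c\<close> add up to the binomial. The bound on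
  \<open>c\<close> keeps these subtractions from truncating; the additive form avoids one
  more.\<close>

lemma card_residue_difference_pairs:
  fixes c L :: nat
  assumes "c \<le> L"
  shows "card (SIGMA r:{..<c}. {1..<L - r}) + (c + 1 choose 2) = c * L"
  using assms
proof (induction c)
  case (Suc c)
  have "card (SIGMA r:{..<Suc c}. {1..<L - r}) = card (SIGMA r:{..<c}. {1..<L - r}) + (L - c - 1)"
    by (simp add: card_SigmaI)
  moreover have "(Suc c + 1 choose 2) = (c + 1 choose 2) + Suc c"
    by (simp add: numeral_2_eq_2)
  ultimately show ?case
    using Suc by simp
qed simp

lemma card_2_nat_set:
  fixes B :: "nat set"
  assumes "card B = 2"
  shows "Min B < Max B" and "B = {Min B, Max B}"
proof -
  obtain x y where "B = {x, y}" "x < y"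
    using assms by (metis card_2_iff insert_commute linorder_neqE_nat)
  then show "Min B < Max B" and "B = {Min B, Max B}"
    by auto
qed

lemma sum_choose_2_bound:
  fixes c :: nat
  assumes c: "c \<ge> 1" "c \<le> dim_col Hs"
    and free: "\<not> (\<exists>vs. local_cycle (tanner_nodes Hs) (tanner_edges c Hs) vs \<and> walk_length vs < 6)"
  shows "(\<Sum>i<dim_row Hs. card {j. j < dim_col Hs \<and> Hs $$ (i, j) = 1} choose 2) + (c + 1 choose 2)
    \<le> c * dim_col Hs"
proof -
  define S where "S i = {j. j < dim_col Hs \<and> Hs $$ (i, j) = 1}" for i
  \<comment> \<open>Encoding a pair of positions as a two-element set makes the count per row a
    binomial coefficient; \<open>Min\<close> and \<open>Max\<close> recover the order.\<close>
  define P where "P = (SIGMA i:{..<dim_row Hs}. {B. B \<subseteq> S i \<and> card B = 2})"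
  define f where "f = (\<lambda>(i :: nat, B :: nat set). (Min B mod c, Max B - Min B))"
  let ?T = "SIGMA r:{..<c}. {1..<dim_col Hs - r}"
  have fin: "finite (S i)" for i
    by (simp add: S_def)
  have P_D: "i < dim_row Hs" "Min B < Max B" "B = {Min B, Max B}" "Min B \<in> S i" "Max B \<in> S i"
    if "(i, B) \<in> P" for i B
    using that card_2_nat_set[of B] by (auto simp: P_def)
  have "inj_on f P"
  proof (rule inj_onI, clarify)
    fix i B l C
    assume B: "(i, B) \<in> P" and C: "(l, C) \<in> P" and eq: "f (i, B) = f (l, C)"
    have "i = l \<and> Min B = Min C \<and> Max B = Max C"
      by (rule pair_of_ones_unique[OF free])
        (use P_D[OF B] P_D[OF C] eq in \<open>auto simp: f_def S_def\<close>)
    then show "i = l \<and> B = C"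
      using P_D(3)[OF B] P_D(3)[OF C] by metis
  qed
  moreover have "f ` P \<subseteq> ?T"
  proof clarify
    fix i B r d
    assume B: "(i, B) \<in> P" and f: "(r, d) = f (i, B)"
    \<comment> \<open>Replacing \<open>Min B\<close> by its residue can only decrease it, so residue
      plus difference is at most \<open>Max B\<close>, which is a column index.\<close>
    have "Max B - Min B < dim_col Hs - Min B mod c"
      using P_D[OF B] mod_less_eq_dividend[of "Min B" c] unfolding S_def mem_Collect_eq by linarith
    then show "r \<in> {..<c} \<and> d \<in> {1..<dim_col Hs - r}"
      using P_D[OF B] f c by (auto simp: f_def S_def)
  qed
  moreover have "finite ?T"
    by simp
  ultimately have "card P \<le> card ?T"
    by (rule card_inj_on_le)
  moreover have "card P = (\<Sum>i<dim_row Hs. card (S i) choose 2)"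
    unfolding P_def using fin by (simp add: card_SigmaI n_subsets)
  ultimately show ?thesis
    using card_residue_difference_pairs[OF c(2)] unfolding S_def by linarith
qed

theorem mainTheorem1:
  fixes a c Lh :: nat and Hs :: "bit mat" and w :: "nat \<Rightarrow> nat"
  assumes "c \<ge> 1" and "a > c" and "Lh > c"
    and "Hs \<in> carrier_mat a Lh"
    and "\<And>i. i < a \<Longrightarrow> card {j. j < Lh \<and> Hs $$ (i, j) = 1} = w i"
    and "\<And>i. i < a \<Longrightarrow> w i \<ge> 1"
    and "\<not> (\<exists>vs. local_cycle (tanner_nodes Hs) (tanner_edges c Hs) vs \<and> walk_length vs < 6)"
  shows "int Lh \<ge> max (int c + 1)
    \<lceil>(real (\<Sum>i<a. w i choose 2) + real ((c + 1) choose 2)) / real c\<rceil>"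
proof -
  have dims: "dim_row Hs = a" "dim_col Hs = Lh"
    using assms(4) by auto
  have "(\<Sum>i<a. w i choose 2) + (c + 1 choose 2) \<le> c * Lh"
    using sum_choose_2_bound[OF assms(1) _ assms(7)] assms(3,5) by (simp add: dims)
  then have "real (\<Sum>i<a. w i choose 2) + real ((c + 1) choose 2) \<le> real Lh * real c"
    by (metis of_nat_add of_nat_le_iff of_nat_mult mult.commute)
  then have "(real (\<Sum>i<a. w i choose 2) + real ((c + 1) choose 2)) / real c \<le> real Lh"
    using assms(1) by (simp add: divide_le_eq)
  \<comment> \<open>The ceiling may be dropped because \<open>Lh\<close> is an integer; the other
    entry of the maximum is \<open>Lh > c\<close>.\<close>
  then show ?thesis
    using assms(3) by (simp add: ceiling_le_iff)
qed

end
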